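(* Let $K^0(T)\xrightarrow{d^c}K^1(T)\xrightarrow{d^c}K^2(T)$ be the real cochain complex of the combinatorial torus (the $2\times 2$ periodic square grid), and for $r=0,1,2$ let $\mathcal{H}^r(T)=N_{d^c}^r(T)/R_{d^c}^r(T)$ be its $r$-th cohomology group, where $N_{d^c}^r(T)=\{\omega\in K^r(T):\ d^c\omega=0\}$ is the space of closed $r$-forms and $R_{d^c}^r(T)=\{d^c\varphi:\ \varphi\in K^{r-1}(T)\}$ is the space of exact $r$-forms (with $R_{d^c}^0(T)=\{0\}$). Then $$\mathcal{H}^0(T)\cong\mathbb{R},\qquad \mathcal{H}^1(T)\cong\mathbb{R}^2,\qquad \mathcal{H}^2(T)\cong\mathbb{R}.$$
   Context: The combinatorial torus is the complex obtained from the $2\times2$ array of unit squares $V_{k,s}$, $k,s\in\{1,2\}$, by identifying opposite sides with the same orientation, so that all indices $k$ and $s$ are read modulo $2$ (with representatives $1,2$); it has vertices $x_{k,s}$, horizontal edges $e^1_{k,s}$ from $x_{k,s}$ to $x_{k+1,s}$, vertical edges $e^2_{k,s}$ from $x_{k,s}$ to $x_{k,s+1}$, and squares $V_{k,s}$ with boundary $\partial V_{k,s}=e^1_{k,s}+e^2_{k+1,s}-e^1_{k,s+1}-e^2_{k,s}$. The dual cochain spaces with real coefficients have the dual bases: $K^0(T)$ consists of $\varphi=\sum_{k,s=1}^2\varphi_{k,s}x^{k,s}$, $K^1(T)$ of $\omega=\sum_{k,s=1}^2(u_{k,s}e_1^{k,s}+v_{k,s}e_2^{k,s})$, $K^2(T)$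 of $\psi=\sum_{k,s=1}^2\psi_{k,s}V^{k,s}$. The coboundary $d^c$ is dual to $\partial$; explicitly, with indices modulo $2$, $d^c\varphi=\sum_{k,s}\big((\varphi_{k+1,s}-\varphi_{k,s})e_1^{k,s}+(\varphi_{k,s+1}-\varphi_{k,s})e_2^{k,s}\big)$, $d^c\omega=\sum_{k,s}\big((v_{k+1,s}-v_{k,s})-(u_{k,s+1}-u_{k,s})\big)V^{k,s}$, and $d^c\psi=0$. Isomorphisms are isomorphisms of real vector spaces. *)

theory Defs
  imports "HOL-Analysis.Analysis"
begin

text \<open>
  The indices \<open>k\<close>, \<open>s\<close> range over the library type \<^typ>\<open>2\<close> of integers modulo 2, in which
  \<open>2 = 0\<close>; hence \<open>k + 1\<close> is automatically read modulo 2. The component with index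
  \<open>(k, s)\<close> of \<open>a\<close> is \<open>a $ k $ s\<close>. An element \<open>(u, v)\<close> of degree 1 has the horizontal
  components \<open>u\<close> and the vertical components \<open>v\<close>.
\<close>

type_synonym deg0 = "real ^ 2 ^ 2"
type_synonym deg1 = "(real ^ 2 ^ 2) \<times> (real ^ 2 ^ 2)"
type_synonym deg2 = "real ^ 2 ^ 2"

definition vertex :: "2 \<Rightarrow> 2 \<Rightarrow> deg0" where
  "vertex k s = axis k (axis s 1)"

definition edge1 :: "2 \<Rightarrow> 2 \<Rightarrow> deg1" where
  "edge1 k s = (axis k (axis s 1), 0)"

definition edge2 :: "2 \<Rightarrow> 2 \<Rightarrow> deg1" where
  "edge2 k s = (0, axis k (axis s 1))"

definition boundary1 :: "deg1 \<Rightarrow> deg0" where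
  "boundary1 c = (\<Sum>k\<in>UNIV. \<Sum>s\<in>UNIV.
     (fst c $ k $ s) *\<^sub>R (vertex (k + 1) s - vertex k s) +
     (snd c $ k $ s) *\<^sub>R (vertex k (s + 1) - vertex k s))"

definition boundary2 :: "deg2 \<Rightarrow> deg1" where
  "boundary2 c = (\<Sum>k\<in>UNIV. \<Sum>s\<in>UNIV.
     (c $ k $ s) *\<^sub>R (edge1 k s + edge2 (k + 1) s - edge1 k (s + 1) - edge2 k s))"

definition dc0 :: "deg0 \<Rightarrow> deg1" where
  "dc0 \<phi> = ((\<chi> k s. \<phi> $ (k + 1) $ s - \<phi> $ k $ s), (\<chi> k s. \<phi> $ k $ (s + 1) - \<phi> $ k $ s))"

definition dc1 :: "deg1 \<Rightarrow> deg2" where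
  "dc1 \<omega> = (case \<omega> of (u, v) \<Rightarrow>
     (\<chi> k s. (v $ (k + 1) $ s - v $ k $ s) - (u $ k $ (s + 1) - u $ k $ s)))"

text \<open>There are no 3-cells; only the fact that the value is zero matters, not its type.\<close>

definition dc2 :: "deg2 \<Rightarrow> real" where
  "dc2 \<psi> = 0"

text \<open>
  The pairing of cochains with chains for which the bases are dual to each other is the
  standard inner product of the coefficient arrays.
\<close>

lemma three_mod_2: "(3::2) = 1"
  by simp

lemma dc0_dual: "inner (dc0 \<phi>) c = inner \<phi> (boundary1 c)"
  by (simp add: dc0_def boundary1_def vertex_def inner_prod_def inner_vec_def sum_2 axis_def
      three_mod_2 algebra_simps)

lemma dc1_dual: "inner (dc1 \<omega>) c = inner \<omega> (boundary2 c)"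
  by (cases \<omega>) (simp add: dc1_def boundary2_def edge1_def edge2_def inner_prod_def
      inner_vec_def sum_2 axis_def three_mod_2 algebra_simps)

lemma dc1_dc0: "dc1 (dc0 \<phi>) = 0"
  by (simp add: dc1_def dc0_def vec_eq_iff)

lemma linear_dc0: "linear dc0"
  by (rule linearI) (simp_all add: dc0_def vec_eq_iff algebra_simps)

lemma linear_dc1: "linear dc1"
  by (rule linearI) (simp_all add: dc1_def case_prod_unfold vec_eq_iff algebra_simps)

lemma linear_dc2: "linear dc2"
  by (rule linearI) (simp_all add: dc2_def)

definition closed0 :: "deg0 set" where "closed0 = {\<phi>. dc0 \<phi> = 0}"
definition closed1 :: "deg1 set" where "closed1 = {\<omega>. dc1 \<omega> = 0}"
definition closed2 :: "deg2 set" where "closed2 = {\<psi>. dc2 \<psi> = 0}"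

definition exact0 :: "deg0 set" where "exact0 = {0}"
definition exact1 :: "deg1 set" where "exact1 = {dc0 \<phi> | \<phi>. True}"
definition exact2 :: "deg2 set" where "exact2 = {dc1 \<omega> | \<omega>. True}"

lemma subspace_closed:
  "subspace closed0" "subspace closed1" "subspace closed2"
  unfolding closed0_def closed1_def closed2_def
  by (simp_all add: linear_subspace_kernel linear_dc0 linear_dc1 linear_dc2)

lemma subspace_exact:
  "subspace exact0" "subspace exact1" "subspace exact2"
proof -
  show "subspace exact0"
    by (simp add: exact0_def)
  have "exact1 = range dc0" "exact2 = range dc1"
    by (auto simp: exact1_def exact2_def)
  then show "subspace exact1" "subspace exact2"
    using linear_subspace_image[OF linear_dc0 subspace_UNIV]
      linear_subspace_image[OF linear_dc1 subspace_UNIV] by simp_all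
qed

lemma exact_subset_closed:
  "exact0 \<subseteq> closed0" "exact1 \<subseteq> closed1" "exact2 \<subseteq> closed2"
  by (auto simp: exact0_def exact1_def exact2_def closed0_def closed1_def closed2_def
      dc1_dc0 dc2_def linear_0[OF linear_dc0])

text \<open>
  For subspaces \<open>R \<subseteq> N\<close>, the following is a partial equivalence relation with domain \<open>N\<close>
  whose classes are the cosets of \<open>R\<close> in \<open>N\<close>, so its quotient type is \<open>N / R\<close>.
\<close>

definition quot_rel :: "'a::real_vector set \<Rightarrow> 'a set \<Rightarrow> 'a \<Rightarrow> 'a \<Rightarrow> bool" where
  "quot_rel N R x y \<longleftrightarrow> x \<in> N \<and> y \<in> N \<and> x - y \<in> R"

lemma part_equivp_quot_rel:
  assumes "subspace N" "subspace R"
  shows "part_equivp (quot_rel N R)"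
proof (rule part_equivpI)
  show "\<exists>x. quot_rel N R x x"
    using assms by (auto simp: quot_rel_def intro!: exI[of _ 0] subspace_0)
  show "symp (quot_rel N R)"
    using subspace_neg[OF assms(2)] by (force simp: symp_def quot_rel_def)
  show "transp (quot_rel N R)"
    using subspace_add[OF assms(2)] by (force simp: transp_def quot_rel_def)
qed

lemma quot_rel_zero:
  "subspace N \<Longrightarrow> subspace R \<Longrightarrow> quot_rel N R 0 0"
  by (simp add: quot_rel_def subspace_0)

lemma quot_rel_add:
  assumes "subspace N" "subspace R" "quot_rel N R x x'" "quot_rel N R y y'"
  shows "quot_rel N R (x + y) (x' + y')"
  using assms subspace_add[of R "x - x'" "y - y'"]
  by (auto simp: quot_rel_def subspace_add algebra_simps)

lemma quot_rel_scale:
  assumes "subspace N" "subspace R" "quot_rel N R x x'"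
  shows "quot_rel N R (c *\<^sub>R x) (c *\<^sub>R x')"
  using assms subspace_scale[of R "x - x'" c]
  by (auto simp: quot_rel_def subspace_scale algebra_simps)

lemma quot_rel_minus:
  assumes "subspace N" "subspace R" "quot_rel N R x x'"
  shows "quot_rel N R (- x) (- x')"
  using quot_rel_scale[OF assms, of "-1"] by simp

lemma quot_rel_diff:
  assumes "subspace N" "subspace R" "quot_rel N R x x'" "quot_rel N R y y'"
  shows "quot_rel N R (x - y) (x' - y')"
  using quot_rel_add[OF assms(1-3) quot_rel_minus[OF assms(1,2,4)]] by simp

lemma quot_rel_refl:
  "subspace R \<Longrightarrow> x \<in> N \<Longrightarrow> quot_rel N R x x"
  by (simp add: quot_rel_def subspace_0)

quotient_type H0 = deg0 / partial: "quot_rel closed0 exact0"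
  by (intro part_equivp_quot_rel subspace_closed subspace_exact)

instantiation H0 :: real_vector
begin

lift_definition zero_H0 :: H0 is 0
  by (intro quot_rel_zero subspace_closed subspace_exact)

lift_definition plus_H0 :: "H0 \<Rightarrow> H0 \<Rightarrow> H0" is "(+)"
  by (intro quot_rel_add subspace_closed subspace_exact)

lift_definition uminus_H0 :: "H0 \<Rightarrow> H0" is uminus
  by (intro quot_rel_minus subspace_closed subspace_exact)

lift_definition minus_H0 :: "H0 \<Rightarrow> H0 \<Rightarrow> H0" is "(-)"
  by (intro quot_rel_diff subspace_closed subspace_exact)

lift_definition scaleR_H0 :: "real \<Rightarrow> H0 \<Rightarrow> H0" is "(*\<^sub>R)"
  by (intro quot_rel_scale subspace_closed subspace_exact)

instance
  by standard
    (transfer, auto simp: quot_rel_def algebra_simps subspace_0 subspace_add subspace_diff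
       subspace_neg subspace_scale subspace_closed subspace_exact)+

end

quotient_type H1 = deg1 / partial: "quot_rel closed1 exact1"
  by (intro part_equivp_quot_rel subspace_closed subspace_exact)

instantiation H1 :: real_vector
begin

lift_definition zero_H1 :: H1 is 0
  by (intro quot_rel_zero subspace_closed subspace_exact)

lift_definition plus_H1 :: "H1 \<Rightarrow> H1 \<Rightarrow> H1" is "(+)"
  by (intro quot_rel_add subspace_closed subspace_exact)

lift_definition uminus_H1 :: "H1 \<Rightarrow> H1" is uminus
  by (intro quot_rel_minus subspace_closed subspace_exact)

lift_definition minus_H1 :: "H1 \<Rightarrow> H1 \<Rightarrow> H1" is "(-)"
  by (intro quot_rel_diff subspace_closed subspace_exact)

lift_definition scaleR_H1 :: "real \<Rightarrow> H1 \<Rightarrow> H1" is "(*\<^sub>R)"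
  by (intro quot_rel_scale subspace_closed subspace_exact)

instance
  by standard
    (transfer, auto simp: quot_rel_def algebra_simps subspace_0 subspace_add subspace_diff
       subspace_neg subspace_scale subspace_closed subspace_exact)+

end

quotient_type H2 = deg2 / partial: "quot_rel closed2 exact2"
  by (intro part_equivp_quot_rel subspace_closed subspace_exact)

instantiation H2 :: real_vector
begin

lift_definition zero_H2 :: H2 is 0
  by (intro quot_rel_zero subspace_closed subspace_exact)

lift_definition plus_H2 :: "H2 \<Rightarrow> H2 \<Rightarrow> H2" is "(+)"
  by (intro quot_rel_add subspace_closed subspace_exact)

lift_definition uminus_H2 :: "H2 \<Rightarrow> H2" is uminus
  by (intro quot_rel_minus subspace_closed subspace_exact)

lift_definition minus_H2 :: "H2 \<Rightarrow> H2 \<Rightarrow> H2" is "(-)"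
  by (intro quot_rel_diff subspace_closed subspace_exact)

lift_definition scaleR_H2 :: "real \<Rightarrow> H2 \<Rightarrow> H2" is "(*\<^sub>R)"
  by (intro quot_rel_scale subspace_closed subspace_exact)

instance
  by standard
    (transfer, auto simp: quot_rel_def algebra_simps subspace_0 subspace_add subspace_diff
       subspace_neg subspace_scale subspace_closed subspace_exact)+

end

end

(* A class is determined by its periods: the value at a vertex in degree 0, the integrals along
   one horizontal and one vertical cycle in degree 1, the integral over the whole torus in
   degree 2. A closed form is exact precisely when its periods vanish (Stokes in one direction,
   an explicit primitive in the other), and every period is attained by a closed form. *)

theory Submission
  imports Defs
begin

definition period0 :: "deg0 \<Rightarrow> real" where
  "period0 \<phi> = \<phi> $ 1 $ 1"

definition period1 :: "deg1 \<Rightarrow> real ^ 2" where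
  "period1 \<omega> = vector [fst \<omega> $ 1 $ 1 + fst \<omega> $ 2 $ 1, snd \<omega> $ 1 $ 1 + snd \<omega> $ 1 $ 2]"

definition period2 :: "deg2 \<Rightarrow> real" where
  "period2 \<psi> = (\<Sum>k\<in>UNIV. \<Sum>s\<in>UNIV. \<psi> $ k $ s)"

lemma linear_period0: "linear period0"
  by (rule linearI) (simp_all add: period0_def)

lemma linear_period1: "linear period1"
  by (rule linearI) (simp_all add: period1_def vec_eq_iff forall_2 algebra_simps)

lemma linear_period2: "linear period2"
  by (rule linearI) (simp_all add: period2_def sum_2 algebra_simps)

lemma exact0_iff_period0:
  assumes "\<phi> \<in> closed0"
  shows "\<phi> \<in> exact0 \<longleftrightarrow> period0 \<phi> = 0"
proof -
  have "\<phi> $ (k + 1) $ s = \<phi> $ k $ s" "\<phi> $ k $ (s + 1) = \<phi> $ k $ s" for k s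
    using assms by (simp_all add: closed0_def dc0_def zero_prod_def vec_eq_iff)
  \<comment> \<open>Three shifts starting from the vertex \<open>(1, 1)\<close> reach all the
    others, so a closed 0-form is constant.\<close>
  from this(1)[of 1 1] this(2)[of 1 1] this(1)[of 1 2]
  have "\<phi> $ 2 $ 1 = \<phi> $ 1 $ 1" "\<phi> $ 1 $ 2 = \<phi> $ 1 $ 1" "\<phi> $ 2 $ 2 = \<phi> $ 1 $ 1"
    by simp_all
  then show ?thesis
    by (auto simp: exact0_def period0_def vec_eq_iff forall_2)
qed

lemma exact1_iff_period1:
  assumes "\<omega> \<in> closed1"
  shows "\<omega> \<in> exact1 \<longleftrightarrow> period1 \<omega> = 0"
proof
  assume "\<omega> \<in> exact1"
  then show "period1 \<omega> = 0"
    \<comment> \<open>Around each cycle the two differences cancel; \<open>three_mod_2\<close> sends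
      the index \<open>2 + 1\<close> back to \<open>1\<close>.\<close>
    by (auto simp: exact1_def period1_def dc0_def vec_eq_iff forall_2 three_mod_2)
next
  assume "period1 \<omega> = 0"
  moreover obtain u v where \<omega>: "\<omega> = (u, v)"
    by (cases \<omega>)
  \<comment> \<open>The primitive integrates the form from the vertex \<open>(1, 1)\<close>, first
    horizontally, then vertically. The vanishing periods handle the edges that close the two cycles;
    closedness then gives the remaining ones.\<close>
  ultimately have "\<omega> = dc0 (vector [vector [0, v $ 1 $ 1],
      vector [u $ 1 $ 1, u $ 1 $ 1 + v $ 2 $ 1]])"
    using assms
    by (simp add: closed1_def dc1_def dc0_def period1_def vec_eq_iff forall_2 three_mod_2)
  then show "\<omega> \<in> exact1"
    by (auto simp: exact1_def)
qed

lemma exact2_iff_period2: "\<psi> \<in> exact2 \<longleftrightarrow> period2 \<psi> = 0"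
proof
  assume "\<psi> \<in> exact2"
  then show "period2 \<psi> = 0"
    \<comment> \<open>Each edge borders two squares with opposite signs, so everything
      cancels.\<close>
    by (auto simp: exact2_def period2_def dc1_def sum_2 three_mod_2)
next
  assume "period2 \<psi> = 0"
  \<comment> \<open>The primitive lives on the three edges crossed by the path of squares
    \<open>(2, 1)\<close>, \<open>(1, 1)\<close>, \<open>(1, 2)\<close>, \<open>(2, 2)\<close>. The
    end squares fix the two vertical values, and \<open>(1, 1)\<close> fixes the horizontal one. The
    equation at \<open>(1, 2)\<close> is then the vanishing of the total.\<close>
  then have "\<psi> = dc1 (vector [vector [0, - \<psi> $ 2 $ 1 - \<psi> $ 1 $ 1], 0],
      vector [0, vector [- \<psi> $ 2 $ 1, - \<psi> $ 2 $ 2]])"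
    by (simp add: dc1_def period2_def sum_2 vec_eq_iff forall_2 three_mod_2)
  then show "\<psi> \<in> exact2"
    by (auto simp: exact2_def)
qed

lemma closed2_UNIV: "closed2 = UNIV"
  by (simp add: closed2_def dc2_def)

lemma period0_surj: "\<exists>\<phi>\<in>closed0. period0 \<phi> = c"
  by (rule bexI[of _ "\<chi> k s. c"])
    (simp_all add: closed0_def period0_def dc0_def zero_prod_def vec_eq_iff)

lemma period1_surj: "\<exists>\<omega>\<in>closed1. period1 \<omega> = c"
  \<comment> \<open>Constant components are closed; each cycle has two edges, hence the
    halves.\<close>
  by (rule bexI[of _ "((\<chi> k s. c $ 1 / 2), (\<chi> k s. c $ 2 / 2))"])
    (simp_all add: closed1_def period1_def dc1_def vec_eq_iff forall_2)

lemma period2_surj: "\<exists>\<psi>\<in>closed2. period2 \<psi> = c"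
  by (rule bexI[of _ "\<chi> k s. c / 4"]) (simp_all add: closed2_UNIV period2_def sum_2)

text \<open>Apply the kernel description to \<open>x - y\<close>. One direction makes the period
  well defined on classes, the other makes it injective there.\<close>

lemma period_eq_iff_quot_rel:
  assumes "subspace N" "linear p" "\<And>z. z \<in> N \<Longrightarrow> z \<in> R \<longleftrightarrow> p z = 0" "x \<in> N" "y \<in> N"
  shows "p x = p y \<longleftrightarrow> quot_rel N R x y"
  using assms by (simp add: quot_rel_def subspace_diff linear_diff)

lemma period0_eq_iff:
  assumes "x \<in> closed0" "y \<in> closed0"
  shows "period0 x = period0 y \<longleftrightarrow> quot_rel closed0 exact0 x y"
  by (intro period_eq_iff_quot_rel subspace_closed linear_period0 exact0_iff_period0 assms)

lemma period1_eq_iff: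
  assumes "x \<in> closed1" "y \<in> closed1"
  shows "period1 x = period1 y \<longleftrightarrow> quot_rel closed1 exact1 x y"
  by (intro period_eq_iff_quot_rel subspace_closed linear_period1 exact1_iff_period1 assms)

lemma period2_eq_iff:
  assumes "x \<in> closed2" "y \<in> closed2"
  shows "period2 x = period2 y \<longleftrightarrow> quot_rel closed2 exact2 x y"
  by (intro period_eq_iff_quot_rel subspace_closed linear_period2 exact2_iff_period2 assms)

lift_definition class_period0 :: "H0 \<Rightarrow> real" is period0
  using period0_eq_iff by (simp add: quot_rel_def)

lift_definition class_period1 :: "H1 \<Rightarrow> real ^ 2" is period1
  using period1_eq_iff by (simp add: quot_rel_def)

lift_definition class_period2 :: "H2 \<Rightarrow> real" is period2
  using period2_eq_iff by (simp add: quot_rel_def)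

lemma linear_class_period0: "linear class_period0"
  by (rule linearI; transfer) (simp_all add: linear_period0 linear_add linear_scale)

lemma linear_class_period1: "linear class_period1"
  by (rule linearI; transfer) (simp_all add: linear_period1 linear_add linear_scale)

lemma linear_class_period2: "linear class_period2"
  by (rule linearI; transfer) (simp_all add: linear_period2 linear_add linear_scale)

lemma bij_class_period0: "bij class_period0"
proof (rule bijI)
  show "inj class_period0"
    \<comment> \<open>Only diagonal instances of \<open>quot_rel\<close> are unfolded: they express
      closedness of a representative, while the general relation must stay intact to match
      \<open>period0_eq_iff\<close>.\<close>
    unfolding inj_def by transfer (auto simp: quot_rel_def[of _ _ x x for x] period0_eq_iff)
  show "surj class_period0"
    unfolding surj_def
    \<comment> \<open>A closed form is related to itself, which is what
      \<open>class_period0.abs_eq\<close> requires to evaluate the period of its class.\<close>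
    by (metis class_period0.abs_eq period0_surj quot_rel_refl subspace_exact(1))
qed

lemma bij_class_period1: "bij class_period1"
proof (rule bijI)
  show "inj class_period1"
    unfolding inj_def by transfer (auto simp: quot_rel_def[of _ _ x x for x] period1_eq_iff)
  show "surj class_period1"
    unfolding surj_def
    by (metis class_period1.abs_eq period1_surj quot_rel_refl subspace_exact(2))
qed

lemma bij_class_period2: "bij class_period2"
proof (rule bijI)
  show "inj class_period2"
    unfolding inj_def by transfer (auto simp: quot_rel_def[of _ _ x x for x] period2_eq_iff)
  show "surj class_period2"
    unfolding surj_def
    by (metis class_period2.abs_eq period2_surj quot_rel_refl subspace_exact(3))
qed

theorem mainTheorem2:
  "(\<exists>f :: H0 \<Rightarrow> real. linear f \<and> bij f) \<and>
   (\<exists>f :: H1 \<Rightarrow> real ^ 2. linear f \<and> bij f) \<and>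
   (\<exists>f :: H2 \<Rightarrow> real. linear f \<and> bij f)"
  using linear_class_period0 bij_class_period0 linear_class_period1 bij_class_period1
    linear_class_period2 bij_class_period2
  by blast

end
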